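(* Let $\tilde\mu>0$, $\kappa>0$ and $\mathcal{T}_->0$ be fixed. There exist positive constants $\delta_0,\varepsilon_0,C$, with $C$ independent of $\varepsilon$ and $\delta$, such that for every $\mathcal{T}_+>0$ with $\delta=|\mathcal{T}_+-\mathcal{T}_-|\le\delta_0$ and every $0<\varepsilon\le\varepsilon_0$, the unique global smooth solution $(v^\varepsilon,u^\varepsilon,\mathcal{T}^\varepsilon)$ of the Cauchy problem described in the context (compressible Navier-Stokes system in Lagrangian coordinates with initial data $(\tilde v,\tilde u,\tilde{\mathcal{T}})(x,0)$) satisfies, for all $t\ge0$, $$\begin{cases}\|(v^\varepsilon-\bar v,\ \mathcal{T}^\varepsilon-\bar{\mathcal{T}})(t)\|_{L^\infty(\mathbb{R})}\le C\delta^{\frac14}\varepsilon^{\frac54}(1+t)^{-\frac12},\\ \|(u^\varepsilon-\bar u)(t)\|_{L^\infty(\mathbb{R})}\le C\delta^{\frac14}\varepsilon^{\frac14}(1+t)^{-\frac12}.\end{cases}$$ In particular both left-hand sides tend to $0$ as $\varepsilon\to0$.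
   Context: The system is $$\begin{cases} v^\varepsilon_t-u^\varepsilon_x=0,\\ u^\varepsilon_t+\frac1{\varepsilon^2}P^\varepsilon_x=\tilde\mu\left(\frac{u^\varepsilon_x}{v^\varepsilon}\right)_x,\\ \left(\mathcal{T}^\varepsilon+\frac12|\varepsilon u^\varepsilon|^2\right)_t+(P^\varepsilon u^\varepsilon)_x=\kappa\left(\frac{1}{v^\varepsilon}\mathcal{T}^\varepsilon_x\right)_x+\varepsilon^2\left(\frac{\tilde\mu}{v^\varepsilon}u^\varepsilon u^\varepsilon_x\right)_x,\end{cases}\qquad P^\varepsilon=\frac{\mathcal{T}^\varepsilon}{v^\varepsilon},\quad x\in\mathbb{R},\ t>0.$$ $\hat{\mathcal{T}}(\eta)$, $\eta=\frac{x}{\sqrt{1+t}}$, is the unique self-similar solution of $\mathcal{T}_t=\left(\frac{\kappa\mathcal{T}_x}{2\mathcal{T}}\right)_x$ with $\lim_{x\to\pm\infty}\mathcal{T}=\mathcal{T}_\pm$. The diffusive wave is $(\bar v,\bar u,\bar{\mathcal{T}})=\left(\hat{\mathcal{T}},\frac{\kappa\hat{\mathcal{T}}_x}{2\hat{\mathcal{T}}},\hat{\mathcal{T}}\right)$, and $(\tilde v,\tilde u,\tilde{\mathcal{T}})=\left(\bar v,\bar u,\bar{\mathcal{T}}-\frac12|\varepsilon\bar u|^2\right)$. The constants $\delta_0,\varepsilon_0$ are such that for $\delta\le\delta_0$, $\varepsilon\le\varepsilon_0$ the Cauchy problem with initial data $(v^\varepsilon,u^\varepsilon,\mathcal{T}^\varepsilon)|_{t=0}=(\tilde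 v,\tilde u,\tilde{\mathcal{T}})(x,0)$ has a unique global smooth solution, which moreover satisfies, for constants $C,C_0>0$ independent of $\varepsilon,\delta$ and all $t\ge 0$, $\|(v^\varepsilon-\tilde v,\varepsilon u^\varepsilon-\varepsilon\tilde u,\mathcal{T}^\varepsilon-\tilde{\mathcal{T}})(t)\|^2_{L^2_x}\le C\sqrt\delta\varepsilon^3(1+t)^{-1+C_0\sqrt\delta}$ and $\|(v^\varepsilon-\tilde v,\varepsilon u^\varepsilon-\varepsilon\tilde u,\mathcal{T}^\varepsilon-\tilde{\mathcal{T}})_x(t)\|^2_{L^2_x}\le C\sqrt\delta\varepsilon^2(1+t)^{-\frac32+C_0\sqrt\delta}$. *)

theory Defs
  imports "HOL-Analysis.Analysis" "HOL-Probability.Essential_Supremum"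
begin

section \<open>Functions on the half-plane\<close>

text \<open>
  Space-time functions are curried, space variable first: \<open>f x t\<close>. Only their values for
  \<open>0 \<le> t\<close> are meaningful.
\<close>

definition dx :: "(real \<Rightarrow> real \<Rightarrow> real) \<Rightarrow> real \<Rightarrow> real \<Rightarrow> real" where
  "dx f x t = deriv (\<lambda>y. f y t) x"

definition dt :: "(real \<Rightarrow> real \<Rightarrow> real) \<Rightarrow> real \<Rightarrow> real \<Rightarrow> real" where
  "dt f x t = deriv (\<lambda>s. f x s) t"

text \<open>
  Smoothness up to and including the initial line \<open>t = 0\<close>: \<open>D i j\<close> is the partial derivative of
  order \<open>i\<close> in \<open>x\<close> and \<open>j\<close> in \<open>t\<close>, one-sided in \<open>t\<close> at \<open>t = 0\<close>, and all of them are jointly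
  continuous.
\<close>

definition smooth_half_plane :: "(real \<Rightarrow> real \<Rightarrow> real) \<Rightarrow> bool" where
  "smooth_half_plane f \<longleftrightarrow>
     (\<exists>D :: nat \<Rightarrow> nat \<Rightarrow> real \<Rightarrow> real \<Rightarrow> real.
        (\<forall>x. \<forall>t\<ge>0. D 0 0 x t = f x t) \<and>
        (\<forall>i j. continuous_on (UNIV \<times> {0..}) (\<lambda>(x, t). D i j x t)) \<and>
        (\<forall>i j x. \<forall>t\<ge>0.
           ((\<lambda>y. D i j y t) has_real_derivative D (Suc i) j x t) (at x) \<and>
           ((\<lambda>s. D i j x s) has_real_derivative D i (Suc j) x t) (at t within {0..})))"

section \<open>Norms\<close>

text \<open>
  Both norms take values in the extended nonnegative reals, so that an inequality with a finite
  right-hand side includes the membership in the space. Tuples carry the Euclidean norm.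
\<close>

definition Linf_norm :: "(real \<Rightarrow> 'a::real_normed_vector) \<Rightarrow> ennreal" where
  "Linf_norm f = esssup lborel (\<lambda>x. ennreal (norm (f x)))"

definition L2_norm_sq :: "(real \<Rightarrow> 'a::real_normed_vector) \<Rightarrow> ennreal" where
  "L2_norm_sq f = (\<integral>\<^sup>+ x. ennreal ((norm (f x))\<^sup>2) \<partial>lborel)"

text \<open>
  \<open>f\<close> belongs to \<open>C([0,\<infinity>); H\<^sup>1(\<real>))\<close>; this is used only for smooth \<open>f\<close>, for which the classical
  derivative is the weak one.
\<close>

definition continuous_in_H1 :: "(real \<Rightarrow> real \<Rightarrow> real) \<Rightarrow> bool" where
  "continuous_in_H1 f \<longleftrightarrow>
     (\<forall>t\<ge>0. L2_norm_sq (\<lambda>x. f x t) < \<infinity> \<and> L2_norm_sq (\<lambda>x. dx f x t) < \<infinity>) \<and>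
     (\<forall>t\<^sub>0\<ge>0. ((\<lambda>t. L2_norm_sq (\<lambda>x. f x t - f x t\<^sub>0) + L2_norm_sq (\<lambda>x. dx f x t - dx f x t\<^sub>0))
                \<longlongrightarrow> 0) (at t\<^sub>0 within {0..}))"

section \<open>The diffusive wave\<close>

text \<open>
  Throughout, \<open>\<Theta>\<close> is the profile of the self-similar solution, a function of
  \<open>\<eta> = x / sqrt (1 + t)\<close>.
\<close>

definition T_bar :: "(real \<Rightarrow> real) \<Rightarrow> real \<Rightarrow> real \<Rightarrow> real" where
  "T_bar \<Theta> x t = \<Theta> (x / sqrt (1 + t))"

definition v_bar :: "(real \<Rightarrow> real) \<Rightarrow> real \<Rightarrow> real \<Rightarrow> real" where
  "v_bar \<Theta> = T_bar \<Theta>"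

definition u_bar :: "real \<Rightarrow> (real \<Rightarrow> real) \<Rightarrow> real \<Rightarrow> real \<Rightarrow> real" where
  "u_bar \<kappa> \<Theta> x t = \<kappa> * dx (T_bar \<Theta>) x t / (2 * T_bar \<Theta> x t)"

definition self_similar_profile :: "real \<Rightarrow> real \<Rightarrow> real \<Rightarrow> (real \<Rightarrow> real) \<Rightarrow> bool" where
  "self_similar_profile \<kappa> T\<^sub>m T\<^sub>p \<Theta> \<longleftrightarrow>
     (\<forall>\<eta>. \<Theta> \<eta> > 0) \<and>
     smooth_half_plane (T_bar \<Theta>) \<and>
     (\<forall>x. \<forall>t>0. dt (T_bar \<Theta>) x t
        = dx (\<lambda>x t. \<kappa> * dx (T_bar \<Theta>) x t / (2 * T_bar \<Theta> x t)) x t) \<and>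
     (\<forall>t\<ge>0. ((\<lambda>x. T_bar \<Theta> x t) \<longlongrightarrow> T\<^sub>m) at_bot \<and> ((\<lambda>x. T_bar \<Theta> x t) \<longlongrightarrow> T\<^sub>p) at_top)"

definition v_tilde :: "(real \<Rightarrow> real) \<Rightarrow> real \<Rightarrow> real \<Rightarrow> real" where
  "v_tilde \<Theta> = v_bar \<Theta>"

definition u_tilde :: "real \<Rightarrow> (real \<Rightarrow> real) \<Rightarrow> real \<Rightarrow> real \<Rightarrow> real" where
  "u_tilde \<kappa> \<Theta> = u_bar \<kappa> \<Theta>"

definition T_tilde :: "real \<Rightarrow> real \<Rightarrow> (real \<Rightarrow> real) \<Rightarrow> real \<Rightarrow> real \<Rightarrow> real" where
  "T_tilde \<kappa> \<epsilon> \<Theta> x t = T_bar \<Theta> x t - (1/2) * \<bar>\<epsilon> * u_bar \<kappa> \<Theta> x t\<bar>\<^sup>2"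

section \<open>The compressible Navier-Stokes system in Lagrangian coordinates\<close>

definition navier_stokes ::
  "real \<Rightarrow> real \<Rightarrow> real \<Rightarrow> (real \<Rightarrow> real \<Rightarrow> real) \<Rightarrow> (real \<Rightarrow> real \<Rightarrow> real) \<Rightarrow> (real \<Rightarrow> real \<Rightarrow> real) \<Rightarrow> bool"
where
  "navier_stokes \<mu> \<kappa> \<epsilon> v u T \<longleftrightarrow>
     (let P = (\<lambda>x t. T x t / v x t) in
      \<forall>x. \<forall>t>0.
        dt v x t - dx u x t = 0 \<and>
        dt u x t + 1 / \<epsilon>\<^sup>2 * dx P x t = \<mu> * dx (\<lambda>x t. dx u x t / v x t) x t \<and>
        dt (\<lambda>x t. T x t + (1/2) * \<bar>\<epsilon> * u x t\<bar>\<^sup>2) x t + dx (\<lambda>x t. P x t * u x t) x t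
          = \<kappa> * dx (\<lambda>x t. 1 / v x t * dx T x t) x t
            + \<epsilon>\<^sup>2 * dx (\<lambda>x t. \<mu> / v x t * u x t * dx u x t) x t)"

text \<open>
  The perturbation of the diffusive wave is required to be continuous in time with values in
  \<open>H\<^sup>1\<close>: without a condition at spatial infinity there is no uniqueness to speak of.
\<close>

definition global_smooth_solution ::
  "real \<Rightarrow> real \<Rightarrow> real \<Rightarrow> (real \<Rightarrow> real) \<Rightarrow>
   (real \<Rightarrow> real \<Rightarrow> real) \<Rightarrow> (real \<Rightarrow> real \<Rightarrow> real) \<Rightarrow> (real \<Rightarrow> real \<Rightarrow> real) \<Rightarrow> bool"
where
  "global_smooth_solution \<mu> \<kappa> \<epsilon> \<Theta> v u T \<longleftrightarrow>
     smooth_half_plane v \<and> smooth_half_plane u \<and> smooth_half_plane T \<and>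
     (\<forall>x. \<forall>t\<ge>0. v x t > 0 \<and> T x t > 0) \<and>
     navier_stokes \<mu> \<kappa> \<epsilon> v u T \<and>
     (\<forall>x. v x 0 = v_tilde \<Theta> x 0 \<and> u x 0 = u_tilde \<kappa> \<Theta> x 0 \<and> T x 0 = T_tilde \<kappa> \<epsilon> \<Theta> x 0) \<and>
     continuous_in_H1 (\<lambda>x t. v x t - v_tilde \<Theta> x t) \<and>
     continuous_in_H1 (\<lambda>x t. u x t - u_tilde \<kappa> \<Theta> x t) \<and>
     continuous_in_H1 (\<lambda>x t. T x t - T_tilde \<kappa> \<epsilon> \<Theta> x t)"

definition uniquely_solvable :: "real \<Rightarrow> real \<Rightarrow> real \<Rightarrow> (real \<Rightarrow> real) \<Rightarrow> bool" where
  "uniquely_solvable \<mu> \<kappa> \<epsilon> \<Theta> \<longleftrightarrow>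
     (\<exists>v u T. global_smooth_solution \<mu> \<kappa> \<epsilon> \<Theta> v u T) \<and>
     (\<forall>v u T v' u' T'.
        global_smooth_solution \<mu> \<kappa> \<epsilon> \<Theta> v u T \<and> global_smooth_solution \<mu> \<kappa> \<epsilon> \<Theta> v' u' T' \<longrightarrow>
        (\<forall>x. \<forall>t\<ge>0. v x t = v' x t \<and> u x t = u' x t \<and> T x t = T' x t))"

definition stability_estimates ::
  "real \<Rightarrow> real \<Rightarrow> real \<Rightarrow> real \<Rightarrow> real \<Rightarrow> (real \<Rightarrow> real) \<Rightarrow>
   (real \<Rightarrow> real \<Rightarrow> real) \<Rightarrow> (real \<Rightarrow> real \<Rightarrow> real) \<Rightarrow> (real \<Rightarrow> real \<Rightarrow> real) \<Rightarrow> bool"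
where
  "stability_estimates C C\<^sub>0 \<delta> \<kappa> \<epsilon> \<Theta> v u T \<longleftrightarrow>
     (let \<phi> = (\<lambda>x t. v x t - v_tilde \<Theta> x t);
          \<psi> = (\<lambda>x t. \<epsilon> * u x t - \<epsilon> * u_tilde \<kappa> \<Theta> x t);
          \<zeta> = (\<lambda>x t. T x t - T_tilde \<kappa> \<epsilon> \<Theta> x t)
      in \<forall>t\<ge>0.
        L2_norm_sq (\<lambda>x. (\<phi> x t, \<psi> x t, \<zeta> x t))
          \<le> ennreal (C * sqrt \<delta> * \<epsilon> ^ 3 * (1 + t) powr (- 1 + C\<^sub>0 * sqrt \<delta>)) \<and>
        L2_norm_sq (\<lambda>x. (dx \<phi> x t, dx \<psi> x t, dx \<zeta> x t))
          \<le> ennreal (C * sqrt \<delta> * \<epsilon>\<^sup>2 * (1 + t) powr (- 3/2 + C\<^sub>0 * sqrt \<delta>)))"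

end

theory Submission
  imports Defs
begin

text \<open>
  The sup norm of each perturbation component is interpolated between the two stability estimates
  (\<open>\<bar>f\<bar>\<^sup>2 \<le> 2 \<parallel>f\<parallel> \<parallel>f'\<parallel>\<close>), which gives the decay \<open>(1 + t)\<close> to the power
  \<open>- 5/8 + C\<^sub>0 sqrt \<delta> / 2\<close>; this is at most \<open>- 1/2\<close> once \<open>C\<^sub>0 sqrt \<delta> \<le> 1/4\<close>. The remaining
  discrepancy \<open>|\<epsilon> u_bar|\<^sup>2 / 2\<close> between \<open>T_tilde\<close> and \<open>T_bar\<close> is controlled through the profile
  equation: the flux \<open>w = \<kappa> \<Theta>' / (2 \<Theta>)\<close> satisfies the linear equation \<open>w' = - (\<eta> \<Theta> / \<kappa>) w\<close>.
  It therefore has a fixed sign and is largest in modulus at \<open>\<eta> = 0\<close>, so \<open>\<Theta>\<close> is monotone, and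
  the increment of \<open>\<Theta>\<close> over \<open>[0, 1]\<close>, which is at most \<open>\<delta>\<close>, bounds \<open>w 0\<close> by a multiple of
  \<open>\<delta>\<close>.
\<close>

section \<open>Agmon's inequality on the real line\<close>

lemma emeasure_lborel_Ici: "emeasure lborel {x :: real..} = \<infinity>"
proof -
  have "ennreal n \<le> emeasure lborel {x..}" if "n \<ge> 0" for n
  proof -
    have "ennreal n = emeasure lborel {x..x + n}" using that by simp
    also have "\<dots> \<le> emeasure lborel {x..}" by (intro emeasure_mono) auto
    finally show ?thesis .
  qed
  \<comment> \<open>A finite measure \<open>r\<close> would have to dominate
    \<open>r + 1\<close>.\<close>
  from this[of "enn2real (emeasure lborel {x..}) + 1"] show ?thesis
    by (cases "emeasure lborel {x..}") auto
qed

text \<open>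
  By Young's inequality \<open>f\<^sup>2\<close> decreases by at most the right-hand side from \<open>x\<close> on; if it started
  above that value, it would stay bounded away from \<open>0\<close>, contradicting integrability.
\<close>

lemma agmon_weighted:
  fixes f f' :: "real \<Rightarrow> real" and A B l :: real
  assumes der: "\<And>x. (f has_real_derivative f' x) (at x)"
    and cont: "continuous_on UNIV f'"
    and A: "(\<integral>\<^sup>+x. ennreal ((f x)\<^sup>2) \<partial>lborel) \<le> ennreal A" "A \<ge> 0"
    and B: "(\<integral>\<^sup>+x. ennreal ((f' x)\<^sup>2) \<partial>lborel) \<le> ennreal B" "B \<ge> 0"
    and l: "l > 0"
  shows "(f x)\<^sup>2 \<le> l * A + B / l"
proof (rule ccontr)
  define K where "K = l * A + B / l"
  \<comment> \<open>\<open>h\<close> is the Young majorant of the derivative of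
    \<open>- (f y)\<^sup>2\<close>; the weighted \<open>L^2\<close> bounds make its integral over
    the whole line at most \<open>K\<close>.\<close>
  define h where "h y = l * (f y)\<^sup>2 + (f' y)\<^sup>2 / l" for y
  assume "\<not> (f x)\<^sup>2 \<le> l * A + B / l"
  hence big: "(f x)\<^sup>2 - K > 0" by (simp add: K_def)
  have cf: "continuous_on UNIV f"
    using der by (meson DERIV_continuous_on has_field_derivative_at_within)
  have cf': "continuous_on S f'" "continuous_on S f" for S
    using cont cf continuous_on_subset by blast+
  have meas [measurable]: "f \<in> borel_measurable borel" "f' \<in> borel_measurable borel"
    using cont cf by (simp_all add: borel_measurable_continuous_onI)
  have h_nonneg: "h y \<ge> 0" for y
    using l by (simp add: h_def)
  have K_nonneg: "K \<ge> 0"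
    using A(2) B(2) l by (simp add: K_def)
  have young: "- (2 * f y * f' y) \<le> h y" for y
  proof -
    \<comment> \<open>Young's inequality in the form of a completed square.\<close>
    have "0 \<le> (l * f y + f' y)\<^sup>2 / l" using l by simp
    also have "\<dots> = h y + 2 * f y * f' y"
      using l by (simp add: h_def field_simps power2_eq_square)
    finally show ?thesis by simp
  qed
  have "(\<integral>\<^sup>+y. ennreal (h y) \<partial>lborel)
      = ennreal l * (\<integral>\<^sup>+y. ennreal ((f y)\<^sup>2) \<partial>lborel)
        + ennreal (1 / l) * (\<integral>\<^sup>+y. ennreal ((f' y)\<^sup>2) \<partial>lborel)"
  proof -
    have "ennreal (h y) = ennreal l * ennreal ((f y)\<^sup>2) + ennreal (1 / l) * ennreal ((f' y)\<^sup>2)" for y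
      using l by (simp add: h_def ennreal_plus ennreal_mult[symmetric] del: ennreal_plus)
        (simp add: ennreal_plus[symmetric] del: ennreal_plus)
    thus ?thesis
      by (simp add: nn_integral_add nn_integral_cmult)
  qed
  also have "\<dots> \<le> ennreal l * ennreal A + ennreal (1 / l) * ennreal B"
    by (intro add_mono mult_left_mono A B) auto
  also have "\<dots> = ennreal K"
    using A(2) B(2) l by (simp add: K_def ennreal_mult[symmetric] ennreal_plus[symmetric] del: ennreal_plus)
  finally have hK: "(\<integral>\<^sup>+y. ennreal (h y) \<partial>lborel) \<le> ennreal K" .
  have int_h: "integrable lborel (\<lambda>z. h z * indicator {x..y} z)" for y
  proof -
    have "set_integrable lborel {x..y} h"
      unfolding h_def using l by (intro borel_integrable_atLeastAtMost' continuous_intros cf') auto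
    thus ?thesis by (simp add: set_integrable_def mult.commute)
  qed
  \<comment> \<open>The drop of \<open>f\<^sup>2\<close> from \<open>x\<close> to \<open>y\<close>
    is the integral of \<open>- 2 f f'\<close>, hence at most the integral of \<open>h\<close> over
    the interval, hence at most \<open>K\<close>.\<close>
  have lower: "(f x)\<^sup>2 - K \<le> (f y)\<^sup>2" if "x \<le> y" for y
  proof -
    have "((\<lambda>y. - ((f y)\<^sup>2)) has_real_derivative - (2 * f y * f' y)) (at y)" for y
      by (auto intro!: derivative_eq_intros der)
    moreover have "isCont (\<lambda>y. - (2 * f y * f' y)) y" for y
      using cont cf by (auto intro!: continuous_intros simp: continuous_on_eq_continuous_at)
    ultimately have "(f x)\<^sup>2 - (f y)\<^sup>2
        = (\<integral>z. - (2 * f z * f' z) * indicator {x..y} z \<partial>lborel)"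
      using integral_FTC_Icc_real[OF that, of "\<lambda>y. - ((f y)\<^sup>2)" "\<lambda>y. - (2 * f y * f' y)"] by simp
    also have "\<dots> \<le> (\<integral>z. h z * indicator {x..y} z \<partial>lborel)"
    proof (rule integral_mono)
      have "set_integrable lborel {x..y} (\<lambda>z. - (2 * f z * f' z))"
        by (intro borel_integrable_atLeastAtMost' continuous_intros cf')
      thus "integrable lborel (\<lambda>z. - (2 * f z * f' z) * indicator {x..y} z)"
        by (simp add: set_integrable_def mult.commute)
    qed (rule int_h, intro mult_right_mono young, simp)
    also have "\<dots> \<le> K"
    proof -
      have "ennreal (\<integral>z. h z * indicator {x..y} z \<partial>lborel)
          \<le> (\<integral>\<^sup>+z. ennreal (h z * indicator {x..y} z) \<partial>lborel)"
        using int_h by (subst nn_integral_eq_integral) (auto simp: h_nonneg)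
      also have "\<dots> \<le> (\<integral>\<^sup>+z. ennreal (h z) \<partial>lborel)"
        by (intro nn_integral_mono) (auto simp: indicator_def h_nonneg)
      finally show ?thesis using hK K_nonneg by (meson ennreal_le_iff order_trans)
    qed
    finally show ?thesis by simp
  qed
  have "ennreal ((f x)\<^sup>2 - K) * emeasure lborel {x..}
      = (\<integral>\<^sup>+y. ennreal ((f x)\<^sup>2 - K) * indicator {x..} y \<partial>lborel)"
    by (simp add: nn_integral_cmult_indicator)
  also have "\<dots> \<le> (\<integral>\<^sup>+y. ennreal ((f y)\<^sup>2) \<partial>lborel)"
    using lower by (intro nn_integral_mono) (auto simp: indicator_def ennreal_leI)
  also have "\<dots> < \<infinity>" using A(1) by (metis ennreal_less_top infinity_ennreal_def le_less_trans)
  finally have "ennreal ((f x)\<^sup>2 - K) * emeasure lborel {x..} < \<infinity>" .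
  thus False
    using big by (simp add: emeasure_lborel_Ici ennreal_mult_top)
qed

text \<open>The weighted bound \<open>l * A + B / l\<close> is smallest at
  \<open>l = sqrt (B / A)\<close>, where it equals \<open>2 * sqrt (A * B)\<close>. This choice
  degenerates when \<open>A\<close> or \<open>B\<close> vanishes, so both are first enlarged by
  \<open>e > 0\<close>, and then \<open>e\<close> tends to \<open>0\<close>.\<close>

lemma agmon_inequality:
  fixes f f' :: "real \<Rightarrow> real" and A B :: real
  assumes der: "\<And>x. (f has_real_derivative f' x) (at x)"
    and cont: "continuous_on UNIV f'"
    and A: "(\<integral>\<^sup>+x. ennreal ((f x)\<^sup>2) \<partial>lborel) \<le> ennreal A" "A \<ge> 0"
    and B: "(\<integral>\<^sup>+x. ennreal ((f' x)\<^sup>2) \<partial>lborel) \<le> ennreal B" "B \<ge> 0"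
  shows "(f x)\<^sup>2 \<le> 2 * sqrt (A * B)"
proof (rule tendsto_lowerbound)
  show "((\<lambda>e. 2 * sqrt ((A + e) * (B + e))) \<longlongrightarrow> 2 * sqrt (A * B)) (at_right 0)"
    by (auto intro!: tendsto_eq_intros)
  have "(f x)\<^sup>2 \<le> 2 * sqrt ((A + e) * (B + e))" if "e > 0" for e
  proof -
    \<comment> \<open>With this \<open>l\<close> both terms of the weighted bound equal
      \<open>a * b\<close>.\<close>
    define a b l where "a = sqrt (A + e)" and "b = sqrt (B + e)" and "l = b / a"
    have pos: "a > 0" "b > 0" and sq: "A + e = a * a" "B + e = b * b"
      using A(2) B(2) that by (auto simp: a_def b_def)
    have "(f x)\<^sup>2 \<le> l * (A + e) + (B + e) / l"
    proof (rule agmon_weighted[OF der cont])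
      show "(\<integral>\<^sup>+x. ennreal ((f x)\<^sup>2) \<partial>lborel) \<le> ennreal (A + e)"
        using A that by (meson add_increasing2 ennreal_leI less_imp_le order_refl order_trans)
      show "(\<integral>\<^sup>+x. ennreal ((f' x)\<^sup>2) \<partial>lborel) \<le> ennreal (B + e)"
        using B that by (meson add_increasing2 ennreal_leI less_imp_le order_refl order_trans)
    qed (use A B that pos in \<open>auto simp: l_def\<close>)
    also have "\<dots> = 2 * (a * b)"
      unfolding sq l_def using pos by (simp add: field_simps)
    finally show ?thesis by (simp add: real_sqrt_mult a_def b_def)
  qed
  thus "\<forall>\<^sub>F e in at_right 0. (f x)\<^sup>2 \<le> 2 * sqrt ((A + e) * (B + e))"
    by (simp add: eventually_at_right_less eventually_at_filter)
qed auto

section \<open>Spatial regularity and the profile equation\<close>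

text \<open>Replaces the witness family \<open>D\<close> by the classical derivatives at a fixed
  time. Only the time derivatives in \<open>D\<close> are one-sided at \<open>t = 0\<close>, so the
  initial line is included.\<close>

lemma smooth_half_plane_dx:
  assumes "smooth_half_plane f" "t \<ge> 0"
  shows "((\<lambda>y. f y t) has_real_derivative dx f x t) (at x)"
    and "continuous_on UNIV (\<lambda>x. dx f x t)"
    and "((\<lambda>x. dx f x t) has_real_derivative deriv (\<lambda>x. dx f x t) x) (at x)"
proof -
  obtain D where D0: "\<forall>x. \<forall>t\<ge>0. D 0 0 x t = f x t"
    and D: "\<forall>i j x. \<forall>t\<ge>0.
      ((\<lambda>y. D i j y t) has_real_derivative D (Suc i) j x t) (at x) \<and>
      ((\<lambda>s. D i j x s) has_real_derivative D i (Suc j) x t) (at t within {0..})"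
    using assms(1) unfolding smooth_half_plane_def by blast
  have der: "((\<lambda>y. D i j y t) has_real_derivative D (Suc i) j x t) (at x)" for i j x
    using D assms(2) by blast
  have 1: "((\<lambda>y. f y t) has_real_derivative D 1 0 x t) (at x)" for x
    using der[of 0 0 x] D0 assms(2) by simp
  hence eq: "dx f x t = D 1 0 x t" for x
    by (simp add: dx_def DERIV_imp_deriv)
  show "((\<lambda>y. f y t) has_real_derivative dx f x t) (at x)"
    using 1 eq by simp
  have 2: "((\<lambda>x. dx f x t) has_real_derivative D 2 0 x t) (at x)" for x
    using der[of 1 0 x] by (simp add: eq numeral_2_eq_2)
  show "continuous_on UNIV (\<lambda>x. dx f x t)"
    using 2 by (meson DERIV_continuous_on has_field_derivative_at_within)
  show "((\<lambda>x. dx f x t) has_real_derivative deriv (\<lambda>x. dx f x t) x) (at x)"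
    using 2[of x] by (simp add: DERIV_imp_deriv)
qed

text \<open>Substituting \<open>\<Theta> (x / sqrt (1 + t))\<close> into the diffusion equation
  turns both sides into functions of \<open>\<eta>\<close> times \<open>1 / (1 + t)\<close>, so a
  single time already determines the ordinary differential equation. With the flux
  \<open>w = \<kappa> \<Theta>' / (2 \<Theta>)\<close> it reads
  \<open>w' = - (\<eta> / 2) \<Theta>'\<close>.\<close>

lemma self_similar_profile_ode:
  assumes prof: "self_similar_profile \<kappa> T\<^sub>m T\<^sub>p \<Theta>"
  shows "(\<Theta> has_real_derivative deriv \<Theta> \<eta>) (at \<eta>)"
    and "continuous_on UNIV (deriv \<Theta>)"
    and "((\<lambda>\<eta>. \<kappa> * deriv \<Theta> \<eta> / (2 * \<Theta> \<eta>)) has_real_derivative - (\<eta> / 2) * deriv \<Theta> \<eta>) (at \<eta>)"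
    and "t \<ge> 0 \<Longrightarrow> dx (T_bar \<Theta>) x t = deriv \<Theta> (x / sqrt (1 + t)) / sqrt (1 + t)"
proof -
  define \<Theta>' where "\<Theta>' x = dx (T_bar \<Theta>) x 0" for x
  have pos: "\<And>\<eta>. \<Theta> \<eta> > 0" and smooth: "smooth_half_plane (T_bar \<Theta>)"
    and pde: "\<And>x t. t > 0 \<Longrightarrow> dt (T_bar \<Theta>) x t
        = dx (\<lambda>x t. \<kappa> * dx (T_bar \<Theta>) x t / (2 * T_bar \<Theta> x t)) x t"
    using prof unfolding self_similar_profile_def by blast+
  \<comment> \<open>At \<open>t = 0\<close> the similarity variable is \<open>x\<close> itself, so
    \<open>\<Theta>\<close> inherits the smoothness of the wave.\<close>
  have T0: "T_bar \<Theta> x 0 = \<Theta> x" for x by (simp add: T_bar_def)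
  have d1: "(\<Theta> has_real_derivative \<Theta>' \<eta>) (at \<eta>)" for \<eta>
    using smooth_half_plane_dx(1)[OF smooth order_refl] by (simp add: T0 \<Theta>'_def)
  have c1: "continuous_on UNIV \<Theta>'"
    using smooth_half_plane_dx(2)[OF smooth order_refl] by (simp add: \<Theta>'_def [abs_def])
  have d2: "(\<Theta>' has_real_derivative deriv \<Theta>' \<eta>) (at \<eta>)" for \<eta>
    using smooth_half_plane_dx(3)[OF smooth order_refl] by (simp add: \<Theta>'_def [abs_def])
  have dxT: "dx (T_bar \<Theta>) x t = \<Theta>' (x / sqrt (1 + t)) / sqrt (1 + t)" if "t \<ge> 0" for x t
  proof -
    have "((\<lambda>y. y / sqrt (1 + t)) has_real_derivative 1 / sqrt (1 + t)) (at x)"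
      by (rule DERIV_cdivide[OF DERIV_ident])
    from DERIV_chain2[OF d1 this] show ?thesis
      unfolding dx_def T_bar_def by (simp add: DERIV_imp_deriv)
  qed
  define w where "w \<eta> = \<kappa> * \<Theta>' \<eta> / (2 * \<Theta> \<eta>)" for \<eta>
  have dw: "(w has_real_derivative deriv w \<eta>) (at \<eta>)" for \<eta>
    unfolding DERIV_deriv_iff_real_differentiable
    using pos[of \<eta>] d1[of \<eta>] d2[of \<eta>] unfolding w_def
    by (intro derivative_intros) (auto simp: real_differentiable_def)
  have "deriv w \<eta> = - (\<eta> / 2) * \<Theta>' \<eta>" for \<eta>
  proof -
    \<comment> \<open>The equation is read off at \<open>t = 3\<close>, where \<open>sqrt (1 + t)\<close> is rational.\<close>
    have s: "sqrt (1 + 3) = (2 :: real)" by (simp add: real_sqrt_eq_iff)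
    have "((\<lambda>t. \<Theta> (2 * \<eta> / sqrt (1 + t))) has_real_derivative \<Theta>' (2 * \<eta> / sqrt (1 + 3)) * (- \<eta> / 8)) (at 3)"
      by (rule DERIV_chain2[OF d1]) (auto intro!: derivative_eq_intros simp: s)
    hence "dt (T_bar \<Theta>) (2 * \<eta>) 3 = \<Theta>' \<eta> * (- \<eta> / 8)"
      unfolding dt_def T_bar_def by (simp add: DERIV_imp_deriv s)
    \<comment> \<open>One factor \<open>1/2\<close> comes from the scaling of
      \<open>dx (T_bar \<Theta>)\<close> at \<open>t = 3\<close>, the other from the chain rule.
      Equating \<open>w' / 4\<close> with the time derivative \<open>- \<eta> \<Theta>' / 8\<close>
      gives the claim.\<close>
    moreover have "dx (\<lambda>x t. \<kappa> * dx (T_bar \<Theta>) x t / (2 * T_bar \<Theta> x t)) (2 * \<eta>) 3 = deriv w \<eta> / 4"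
    proof -
      have "(\<lambda>x. \<kappa> * dx (T_bar \<Theta>) x 3 / (2 * T_bar \<Theta> x 3)) = (\<lambda>x. w (x / 2) / 2)"
        by (simp add: dxT w_def T_bar_def s)
      moreover have "((\<lambda>x. w (x / 2) / 2) has_real_derivative deriv w \<eta> / 4) (at (2 * \<eta>))"
      proof -
        have "((\<lambda>x. x / 2) has_real_derivative 1 / 2) (at (2 * \<eta>))"
          by (rule DERIV_cdivide[OF DERIV_ident])
        from DERIV_cdivide[OF DERIV_chain2[OF dw this], of 2] show ?thesis by simp
      qed
      ultimately show ?thesis unfolding dx_def by (simp add: DERIV_imp_deriv)
    qed
    ultimately show ?thesis using pde[of 3 "2 * \<eta>"] by simp
  qed
  with dw[of \<eta>] have ode: "(w has_real_derivative - (\<eta> / 2) * \<Theta>' \<eta>) (at \<eta>)"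
    by simp
  have "deriv \<Theta> = \<Theta>'"
    by (simp add: fun_eq_iff DERIV_imp_deriv[OF d1])
  with d1[of \<eta>] c1 ode dxT[of t x]
  show "(\<Theta> has_real_derivative deriv \<Theta> \<eta>) (at \<eta>)"
    and "continuous_on UNIV (deriv \<Theta>)"
    and "((\<lambda>\<eta>. \<kappa> * deriv \<Theta> \<eta> / (2 * \<Theta> \<eta>)) has_real_derivative - (\<eta> / 2) * deriv \<Theta> \<eta>) (at \<eta>)"
    and "t \<ge> 0 \<Longrightarrow> dx (T_bar \<Theta>) x t = deriv \<Theta> (x / sqrt (1 + t)) / sqrt (1 + t)"
    by (simp_all add: w_def [abs_def])
qed

section \<open>Size of the flux of the diffusive wave\<close>

lemma limits_bound_monotone:
  fixes f :: "real \<Rightarrow> real"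
  assumes "mono f" "(f \<longlongrightarrow> a) at_bot" "(f \<longlongrightarrow> b) at_top"
  shows "a \<le> f x" "f x \<le> b"
proof -
  have "\<forall>\<^sub>F y in at_bot. f y \<le> f x"
    using eventually_le_at_bot[of x] by eventually_elim (rule monoD[OF assms(1)])
  thus "a \<le> f x"
    by (rule tendsto_upperbound[OF assms(2)]) simp
  have "\<forall>\<^sub>F y in at_top. f x \<le> f y"
    using eventually_ge_at_top[of x] by eventually_elim (rule monoD[OF assms(1)])
  thus "f x \<le> b"
    by (rule tendsto_lowerbound[OF assms(3)]) simp
qed

text \<open>The bounds \<open>m\<close> and \<open>M\<close> on both end states keep the constant
  uniform when \<open>b\<close> varies. The factor \<open>exp (M / \<kappa>)\<close> pays for
  comparing \<open>w 0\<close> with \<open>w\<close> at a mean value point in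
  \<open>(0, 1)\<close>.\<close>

lemma profile_flux_bound:
  fixes \<Theta> \<Theta>' :: "real \<Rightarrow> real"
  assumes "\<kappa> > 0" and pos: "\<And>\<eta>. \<Theta> \<eta> > 0"
    and d: "\<And>\<eta>. (\<Theta> has_real_derivative \<Theta>' \<eta>) (at \<eta>)"
    and ode: "\<And>\<eta>. ((\<lambda>\<eta>. \<kappa> * \<Theta>' \<eta> / (2 * \<Theta> \<eta>)) has_real_derivative - (\<eta> / 2) * \<Theta>' \<eta>) (at \<eta>)"
    and lim: "(\<Theta> \<longlongrightarrow> a) at_bot" "(\<Theta> \<longlongrightarrow> b) at_top"
    and bounds: "0 < m" "m \<le> a" "m \<le> b" "a \<le> M" "b \<le> M"
  shows "\<bar>\<kappa> * \<Theta>' \<eta> / (2 * \<Theta> \<eta>)\<bar> \<le> \<kappa> / (2 * m) * exp (M / \<kappa>) * \<bar>b - a\<bar>"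
proof -
  define w where "w \<eta> = \<kappa> * \<Theta>' \<eta> / (2 * \<Theta> \<eta>)" for \<eta>
  have \<Theta>'_eq: "\<Theta>' \<eta> = 2 * \<Theta> \<eta> * w \<eta> / \<kappa>" for \<eta>
    using \<open>\<kappa> > 0\<close> pos[of \<eta>] by (simp add: w_def)
  have cont: "isCont \<Theta> \<eta>" for \<eta> using d by (rule DERIV_isCont)
  \<comment> \<open>The integrating factor of the linear equation for \<open>w\<close> is
    \<open>exp G\<close>, with \<open>G\<close> an antiderivative of
    \<open>x * \<Theta> x / \<kappa>\<close> normalised by \<open>G 0 = 0\<close>.\<close>
  have "\<exists>F. \<forall>x. -\<infinity> < ereal x \<longrightarrow> ereal x < \<infinity> \<longrightarrow> (F has_vector_derivative x * \<Theta> x / \<kappa>) (at x)"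
    using \<open>\<kappa> > 0\<close> by (intro einterval_antiderivative) (auto intro!: continuous_intros cont)
  then obtain F where F: "\<And>x. (F has_real_derivative x * \<Theta> x / \<kappa>) (at x)"
    by (auto simp: has_real_derivative_iff_has_vector_derivative)
  define G where "G x = F x - F 0" for x
  have G: "(G has_real_derivative x * \<Theta> x / \<kappa>) (at x)" for x
    unfolding G_def by (auto intro!: derivative_eq_intros F)
  \<comment> \<open>The derivative of \<open>G\<close> has the sign of \<open>x\<close>, so
    \<open>G\<close> is minimal at \<open>0\<close>; this makes \<open>w\<close> largest in modulus
    there.\<close>
  have G_nonneg: "G x \<ge> 0" for x
  proof (cases "x \<ge> 0")
    case True
    hence "G 0 \<le> G x"
    proof (rule DERIV_nonneg_imp_nondecreasing)
      fix y :: real assume y: "0 \<le> y" "y \<le> x"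
      have "y * \<Theta> y / \<kappa> \<ge> 0"
        using y less_imp_le[OF pos[of y]] \<open>\<kappa> > 0\<close>
        by simp
      thus "\<exists>D. (G has_real_derivative D) (at y) \<and> D \<ge> 0"
        using G[of y] by blast
    qed
    thus ?thesis by (simp add: G_def)
  next
    case False
    hence "x \<le> 0" by simp
    hence "G 0 \<le> G x"
    proof (rule DERIV_nonpos_imp_nonincreasing)
      fix y :: real assume y: "x \<le> y" "y \<le> 0"
      have "y * \<Theta> y / \<kappa> \<le> 0"
        using y less_imp_le[OF pos[of y]] \<open>\<kappa> > 0\<close>
        by (simp add: divide_nonpos_pos mult_nonpos_nonneg)
      thus "\<exists>D. (G has_real_derivative D) (at y) \<and> D \<le> 0"
        using G[of y] by blast
    qed
    thus ?thesis by (simp add: G_def)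
  qed
  have w': "(w has_real_derivative - (x * \<Theta> x / \<kappa>) * w x) (at x)" for x
  proof -
    have "- (x / 2) * \<Theta>' x = - (x * \<Theta> x / \<kappa>) * w x" by (simp add: \<Theta>'_eq)
    thus ?thesis using ode[of x] by (simp only: w_def [abs_def])
  qed
  have "((\<lambda>x. w x * exp (G x)) has_real_derivative 0) (at x)" for x
    by (auto intro!: derivative_eq_intros w' G simp: algebra_simps)
  hence wG: "w x * exp (G x) = w 0 * exp (G 0)" for x
    using DERIV_isconst_all[of "\<lambda>x. w x * exp (G x)" x 0] by blast
  have w_eq: "\<And>x. w x = w 0 * exp (- G x)"
  proof -
    fix x
    have "w x = (w x * exp (G x)) * exp (- G x)" by (simp add: exp_minus)
    also have "\<dots> = w 0 * exp (- G x)" using wG[of x] by (simp add: G_def)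
    finally show "w x = w 0 * exp (- G x)" .
  qed
  \<comment> \<open>\<open>\<Theta>'\<close> has the constant sign of \<open>w 0\<close>, so
    \<open>\<Theta>\<close> stays between its limits. The \<open>min\<close> and \<open>max\<close>
    bounds control the increment of \<open>\<Theta>\<close>, while \<open>m\<close> and
    \<open>M\<close> enter the constants.\<close>
  have range: "m \<le> \<Theta> x \<and> \<Theta> x \<le> M \<and> min a b \<le> \<Theta> x \<and> \<Theta> x \<le> max a b" for x
  proof (cases "w 0 \<ge> 0")
    case True
    have sign: "\<Theta>' x \<ge> 0" for x
      unfolding \<Theta>'_eq w_eq[of x] using True \<open>\<kappa> > 0\<close> less_imp_le[OF pos] by simp
    have "\<Theta> x \<le> \<Theta> y" if "x \<le> y" for x y
    proof (rule DERIV_nonneg_imp_nondecreasing[OF that])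
      show "\<exists>D. (\<Theta> has_real_derivative D) (at z) \<and> D \<ge> 0" for z
        using d[of z] sign[of z] by blast
    qed
    hence "mono \<Theta>" by (intro monoI)
    from limits_bound_monotone[OF this lim, of x] show ?thesis using bounds by auto
  next
    case False
    have sign: "\<Theta>' x \<le> 0" for x
      unfolding \<Theta>'_eq w_eq[of x] using False \<open>\<kappa> > 0\<close> less_imp_le[OF pos]
      by (intro divide_nonpos_pos mult_nonneg_nonpos mult_nonpos_nonneg) auto
    have "\<Theta> y \<le> \<Theta> x" if "x \<le> y" for x y
    proof (rule DERIV_nonpos_imp_nonincreasing[OF that])
      show "\<exists>D. (\<Theta> has_real_derivative D) (at z) \<and> D \<le> 0" for z
        using d[of z] sign[of z] by blast
    qed
    hence "mono (\<lambda>x. - \<Theta> x)" by (intro monoI) simp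
    from limits_bound_monotone[OF this lim[THEN tendsto_minus], of x] show ?thesis using bounds by auto
  qed
  obtain z where z: "0 < z" "z < 1" "\<Theta> 1 - \<Theta> 0 = (1 - 0) * \<Theta>' z"
    using MVT2[of 0 1 \<Theta> \<Theta>'] d by auto
  \<comment> \<open>A second mean value theorem bounds \<open>G z\<close> by
    \<open>M / \<kappa>\<close>, since \<open>z * y \<le> 1\<close> and
    \<open>\<Theta> y \<le> M\<close>.\<close>
  obtain y where y: "0 < y" "y < z" "G z - G 0 = (z - 0) * (y * \<Theta> y / \<kappa>)"
    using MVT2[OF z(1), of G "\<lambda>y. y * \<Theta> y / \<kappa>"] G by auto
  have "z * y \<le> 1" using y z by (simp add: mult_le_one)
  hence "z * y * \<Theta> y \<le> 1 * M" using range[of y] y z bounds by (intro mult_mono) auto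
  hence Gz: "G z \<le> M / \<kappa>" using y \<open>\<kappa> > 0\<close> by (simp add: G_def divide_right_mono mult.assoc)
  \<comment> \<open>The right-hand side is \<open>\<bar>\<Theta>' z\<bar>\<close>, which by the
    choice of \<open>z\<close> is the increment of \<open>\<Theta>\<close> over
    \<open>[0, 1]\<close>.\<close>
  have "\<bar>w 0\<bar> * exp (- (M / \<kappa>)) * (2 * m / \<kappa>) \<le> \<bar>w z\<bar> * (2 * \<Theta> z / \<kappa>)"
    unfolding w_eq[of z] abs_mult abs_exp_cancel using Gz range[of z] \<open>\<kappa> > 0\<close> \<open>m > 0\<close>
    by (intro mult_mono divide_right_mono) auto
  also have "\<dots> = \<bar>\<Theta>' z\<bar>"
    using pos[of z] \<open>\<kappa> > 0\<close> by (simp add: \<Theta>'_eq abs_mult)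
  also have "\<dots> \<le> \<bar>b - a\<bar>"
    using z(3) range[of 0] range[of 1] by (auto simp: min_def max_def split: if_splits)
  finally have "\<bar>w 0\<bar> \<le> \<kappa> / (2 * m) * exp (M / \<kappa>) * \<bar>b - a\<bar>"
    using \<open>\<kappa> > 0\<close> \<open>m > 0\<close> by (simp add: exp_minus field_simps)
  moreover have "\<bar>w \<eta>\<bar> \<le> \<bar>w 0\<bar>"
    unfolding w_eq[of \<eta>] using G_nonneg[of \<eta>] by (simp add: abs_mult mult_left_le)
  ultimately show ?thesis unfolding w_def by linarith
qed

section \<open>Norm comparisons and regularity of the wave velocity\<close>

lemma norm_triple_sq: "(norm (a :: real, b :: real, c :: real))\<^sup>2 = a\<^sup>2 + b\<^sup>2 + c\<^sup>2"
  by (simp add: norm_Pair)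

lemma L2_norm_sq_component:
  fixes f g h :: "real \<Rightarrow> real"
  shows "L2_norm_sq f \<le> L2_norm_sq (\<lambda>x. (f x, g x, h x))"
    and "L2_norm_sq g \<le> L2_norm_sq (\<lambda>x. (f x, g x, h x))"
    and "L2_norm_sq h \<le> L2_norm_sq (\<lambda>x. (f x, g x, h x))"
  unfolding L2_norm_sq_def norm_triple_sq
  by (auto intro!: nn_integral_mono ennreal_leI)

text \<open>Continuity supplies the measurability required by \<open>esssup_I\<close>.\<close>

lemma Linf_norm_le:
  fixes f :: "real \<Rightarrow> 'a::real_normed_vector"
  assumes "continuous_on UNIV f" "\<And>x. norm (f x) \<le> c"
  shows "Linf_norm f \<le> ennreal c"
  unfolding Linf_norm_def
proof (rule esssup_I)
  have "(\<lambda>x. norm (f x)) \<in> borel_measurable borel"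
    using assms(1) by (intro borel_measurable_continuous_onI continuous_on_norm)
  thus "(\<lambda>x. ennreal (norm (f x))) \<in> borel_measurable lborel" by simp
qed (use assms(2) in \<open>simp add: ennreal_leI\<close>)

text \<open>At time \<open>t\<close> the velocity is the flux at \<open>x / s\<close> divided by
  \<open>s = sqrt (1 + t)\<close>. The profile equation expresses its derivative through
  \<open>deriv \<Theta>\<close> alone, so continuity of \<open>deriv \<Theta>\<close> is
  enough.\<close>

lemma u_bar_C1:
  assumes "self_similar_profile \<kappa> T\<^sub>m T\<^sub>p \<Theta>" "t \<ge> 0"
  shows "((\<lambda>y. u_bar \<kappa> \<Theta> y t) has_real_derivative dx (u_bar \<kappa> \<Theta>) x t) (at x)"
    and "continuous_on UNIV (\<lambda>x. dx (u_bar \<kappa> \<Theta>) x t)"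
proof -
  note ode = self_similar_profile_ode[OF assms(1)]
  define s where "s = sqrt (1 + t)"
  have s: "s > 0" and t: "sqrt (1 + t) = s" using assms(2) by (auto simp: s_def)
  have u: "u_bar \<kappa> \<Theta> x t = \<kappa> * deriv \<Theta> (x / s) / (2 * \<Theta> (x / s)) / s" for x
    using assms(2) by (simp add: u_bar_def ode(4) T_bar_def t mult.commute)
  have d: "((\<lambda>y. u_bar \<kappa> \<Theta> y t) has_real_derivative
      - (x / s / 2) * deriv \<Theta> (x / s) * (1 / s) / s) (at x)" for x
  proof -
    have "((\<lambda>y. y / s) has_real_derivative 1 / s) (at x)"
      by (rule DERIV_cdivide[OF DERIV_ident])
    from DERIV_cdivide[OF DERIV_chain2[OF ode(3) this], of s] show ?thesis
      by (simp only: u)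
  qed
  hence eq: "dx (u_bar \<kappa> \<Theta>) x t = - (x / s / 2) * deriv \<Theta> (x / s) * (1 / s) / s" for x
    unfolding dx_def by (rule DERIV_imp_deriv)
  show "((\<lambda>y. u_bar \<kappa> \<Theta> y t) has_real_derivative dx (u_bar \<kappa> \<Theta>) x t) (at x)"
    unfolding eq by (rule d)
  show "continuous_on UNIV (\<lambda>x. dx (u_bar \<kappa> \<Theta>) x t)"
    unfolding eq using s by (auto intro!: continuous_intros continuous_on_compose2[OF ode(2)])
qed

lemma u_bar_bound:
  assumes prof: "self_similar_profile \<kappa> T\<^sub>m T\<^sub>p \<Theta>" and "\<kappa> > 0" "t \<ge> 0"
    and m: "0 < m" "m \<le> T\<^sub>m" "m \<le> T\<^sub>p" "T\<^sub>m \<le> M" "T\<^sub>p \<le> M"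
  shows "\<bar>u_bar \<kappa> \<Theta> x t\<bar> \<le> \<kappa> / (2 * m) * exp (M / \<kappa>) * \<bar>T\<^sub>p - T\<^sub>m\<bar> / sqrt (1 + t)"
proof -
  note ode = self_similar_profile_ode[OF prof]
  define \<eta> where "\<eta> = x / sqrt (1 + t)"
  have pos: "\<And>\<eta>. \<Theta> \<eta> > 0"
    and "\<forall>t\<ge>0. ((\<lambda>x. T_bar \<Theta> x t) \<longlongrightarrow> T\<^sub>m) at_bot \<and> ((\<lambda>x. T_bar \<Theta> x t) \<longlongrightarrow> T\<^sub>p) at_top"
    using prof unfolding self_similar_profile_def by blast+
  hence lim: "(\<Theta> \<longlongrightarrow> T\<^sub>m) at_bot" "(\<Theta> \<longlongrightarrow> T\<^sub>p) at_top"
    by (auto simp: T_bar_def dest: spec[of _ "0::real"])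
  have "\<bar>u_bar \<kappa> \<Theta> x t\<bar> = \<bar>\<kappa> * deriv \<Theta> \<eta> / (2 * \<Theta> \<eta>)\<bar> / sqrt (1 + t)"
    using \<open>t \<ge> 0\<close> by (simp add: u_bar_def ode(4) T_bar_def \<eta>_def abs_mult mult.commute)
  also have "\<dots> \<le> \<kappa> / (2 * m) * exp (M / \<kappa>) * \<bar>T\<^sub>p - T\<^sub>m\<bar> / sqrt (1 + t)"
    using \<open>t \<ge> 0\<close>
    by (intro divide_right_mono profile_flux_bound[OF \<open>\<kappa> > 0\<close> pos ode(1,3) lim m]) auto
  finally show ?thesis .
qed

section \<open>Decay of the perturbation in the sup norm\<close>

text \<open>Up to constants this is the fourth root of the product of the two stability bounds:
  \<open>\<delta>\<close> from \<open>sqrt \<delta> * sqrt \<delta>\<close>,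
  \<open>\<epsilon> ^ 5\<close> from \<open>\<epsilon> ^ 3 * \<epsilon>\<^sup>2\<close>, with the
  time exponent weakened to \<open>- 1/2\<close>.\<close>

definition rate :: "real \<Rightarrow> real \<Rightarrow> real \<Rightarrow> real" where
  "rate \<delta> \<epsilon> t = \<delta> powr (1/4) * \<epsilon> powr (5/4) * (1 + t) powr (- 1/2)"

lemma rate_nonneg: "rate \<delta> \<epsilon> t \<ge> 0"
  by (simp add: rate_def)

lemma stability_interpolation:
  fixes f f' :: "real \<Rightarrow> real"
  assumes der: "\<And>x. (f has_real_derivative f' x) (at x)" and cont: "continuous_on UNIV f'"
    and nonneg: "C \<ge> 0" "\<delta> \<ge> 0" "\<epsilon> > 0" "t \<ge> 0" and small: "C\<^sub>0 * sqrt \<delta> \<le> 1/4"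
    and A: "L2_norm_sq f \<le> ennreal (C * sqrt \<delta> * \<epsilon> ^ 3 * (1 + t) powr (- 1 + C\<^sub>0 * sqrt \<delta>))"
    and B: "L2_norm_sq f' \<le> ennreal (C * sqrt \<delta> * \<epsilon>\<^sup>2 * (1 + t) powr (- 3/2 + C\<^sub>0 * sqrt \<delta>))"
  shows "\<bar>f x\<bar> \<le> sqrt (2 * C) * rate \<delta> \<epsilon> t"
proof -
  \<comment> \<open>The smallness condition raises the time exponents to at most
    \<open>- 1 + 1/4\<close> and \<open>- 3/2 + 1/4\<close>. Their sum is \<open>- 2\<close>, so the
    fourth root decays exactly like \<open>(1 + t)\<close> to the power
    \<open>- 1/2\<close>.\<close>
  define a b where "a = C * sqrt \<delta> * \<epsilon> ^ 3 * (1 + t) powr (- 3/4)"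
    and "b = C * sqrt \<delta> * \<epsilon>\<^sup>2 * (1 + t) powr (- 5/4)"
  have "L2_norm_sq f \<le> ennreal a"
    unfolding a_def using nonneg small
    by (intro order_trans[OF A] ennreal_leI mult_left_mono powr_mono) auto
  moreover have "L2_norm_sq f' \<le> ennreal b"
    unfolding b_def using nonneg small
    by (intro order_trans[OF B] ennreal_leI mult_left_mono powr_mono) auto
  ultimately have "(f x)\<^sup>2 \<le> 2 * sqrt (a * b)"
    using nonneg
    by (intro agmon_inequality[OF der cont]) (auto simp: L2_norm_sq_def a_def b_def)
  also have "a * b = (C * (rate \<delta> \<epsilon> t)\<^sup>2)\<^sup>2"
  proof -
    have sq: "(x powr p)\<^sup>2 = x powr (2 * p)" for x p :: real
      by (simp add: power2_eq_square flip: powr_add)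
    have r: "(rate \<delta> \<epsilon> t)\<^sup>2 = \<delta> powr (1/2) * \<epsilon> powr (5/2) * (1 + t) powr - 1"
      unfolding rate_def power_mult_distrib sq by simp
    have "\<epsilon> ^ 3 * \<epsilon>\<^sup>2 = (\<epsilon> powr (5/2))\<^sup>2"
      using nonneg by (simp add: sq powr_numeral flip: power_add)
    moreover have "(1 + t) powr (- 3/4) * (1 + t) powr (- 5/4) = ((1 + t) powr - 1)\<^sup>2"
      unfolding sq by (simp flip: powr_add)
    moreover have "sqrt \<delta> = \<delta> powr (1/2)"
      using nonneg by (simp add: powr_half_sqrt)
    ultimately show ?thesis
      unfolding a_def b_def r power_mult_distrib by (simp add: power2_eq_square algebra_simps)
  qed
  also have "2 * sqrt ((C * (rate \<delta> \<epsilon> t)\<^sup>2)\<^sup>2) = (sqrt (2 * C) * rate \<delta> \<epsilon> t)\<^sup>2"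
    unfolding real_sqrt_abs using nonneg by (simp add: power_mult_distrib)
  finally show ?thesis
    by (rule abs_le_square_iff[THEN iffD2, THEN order_trans]) (use nonneg rate_nonneg in simp)
qed

text \<open>Each component is dominated by the Euclidean norm of the triple, so the interpolation
  applies to it separately. The temperature is still compared with \<open>T_tilde\<close>, and the
  velocity still carries the factor \<open>\<epsilon>\<close>, as in the stability estimates. The
  continuity claims prepare \<open>Linf_norm_le\<close>.\<close>

lemma stability_pointwise:
  assumes est: "stability_estimates C C\<^sub>0 \<delta> \<kappa> \<epsilon> \<Theta> v u T"
    and prof: "self_similar_profile \<kappa> T\<^sub>m T\<^sub>p \<Theta>"
    and sol: "global_smooth_solution \<mu> \<kappa> \<epsilon> \<Theta> v u T"
    and nonneg: "C \<ge> 0" "\<delta> \<ge> 0" "\<epsilon> > 0" "t \<ge> 0" and small: "C\<^sub>0 * sqrt \<delta> \<le> 1/4"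
  shows "\<bar>v x t - v_bar \<Theta> x t\<bar> \<le> sqrt (2 * C) * rate \<delta> \<epsilon> t"
    and "\<epsilon> * \<bar>u x t - u_bar \<kappa> \<Theta> x t\<bar> \<le> sqrt (2 * C) * rate \<delta> \<epsilon> t"
    and "\<bar>T x t - T_tilde \<kappa> \<epsilon> \<Theta> x t\<bar> \<le> sqrt (2 * C) * rate \<delta> \<epsilon> t"
    and "continuous_on UNIV (\<lambda>x. v x t - v_bar \<Theta> x t)"
    and "continuous_on UNIV (\<lambda>x. u x t - u_bar \<kappa> \<Theta> x t)"
    and "continuous_on UNIV (\<lambda>x. T x t - T_bar \<Theta> x t)"
proof -
  have sm: "smooth_half_plane v" "smooth_half_plane u" "smooth_half_plane T"
    using sol by (auto simp: global_smooth_solution_def)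
  have smT: "smooth_half_plane (T_bar \<Theta>)"
    using prof by (auto simp: self_similar_profile_def)
  note D = smooth_half_plane_dx(1)[OF _ \<open>t \<ge> 0\<close>] and Dc = smooth_half_plane_dx(2)[OF _ \<open>t \<ge> 0\<close>]
  note U = u_bar_C1(1)[OF prof \<open>t \<ge> 0\<close>] and Uc = u_bar_C1(2)[OF prof \<open>t \<ge> 0\<close>]
  have c: "continuous_on UNIV (\<lambda>y. v y t)" "continuous_on UNIV (\<lambda>y. u y t)"
    "continuous_on UNIV (\<lambda>y. T y t)" "continuous_on UNIV (\<lambda>y. T_bar \<Theta> y t)"
    "continuous_on UNIV (\<lambda>y. u_bar \<kappa> \<Theta> y t)"
    using D[OF sm(1)] D[OF sm(2)] D[OF sm(3)] D[OF smT] U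
    by (blast intro: continuous_at_imp_continuous_on DERIV_isCont)+
  show "continuous_on UNIV (\<lambda>x. v x t - v_bar \<Theta> x t)"
    "continuous_on UNIV (\<lambda>x. u x t - u_bar \<kappa> \<Theta> x t)"
    "continuous_on UNIV (\<lambda>x. T x t - T_bar \<Theta> x t)"
    unfolding v_bar_def by (intro continuous_on_diff c)+
  define \<phi> \<psi> \<zeta> where "\<phi> = (\<lambda>x t. v x t - v_tilde \<Theta> x t)"
    and "\<psi> = (\<lambda>x t. \<epsilon> * u x t - \<epsilon> * u_tilde \<kappa> \<Theta> x t)"
    and "\<zeta> = (\<lambda>x t. T x t - T_tilde \<kappa> \<epsilon> \<Theta> x t)"
  have est1: "L2_norm_sq (\<lambda>x. (\<phi> x t, \<psi> x t, \<zeta> x t))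
      \<le> ennreal (C * sqrt \<delta> * \<epsilon> ^ 3 * (1 + t) powr (- 1 + C\<^sub>0 * sqrt \<delta>))"
    and est2: "L2_norm_sq (\<lambda>x. (dx \<phi> x t, dx \<psi> x t, dx \<zeta> x t))
      \<le> ennreal (C * sqrt \<delta> * \<epsilon>\<^sup>2 * (1 + t) powr (- 3/2 + C\<^sub>0 * sqrt \<delta>))"
    using est \<open>t \<ge> 0\<close> unfolding stability_estimates_def Let_def \<phi>_def \<psi>_def \<zeta>_def by blast+
  have \<phi>: "((\<lambda>y. \<phi> y t) has_real_derivative dx v x t - dx (T_bar \<Theta>) x t) (at x)" for x
    unfolding \<phi>_def v_tilde_def v_bar_def by (intro DERIV_diff D sm smT)
  have \<psi>: "((\<lambda>y. \<psi> y t) has_real_derivative \<epsilon> * dx u x t - \<epsilon> * dx (u_bar \<kappa> \<Theta>) x t) (at x)" for x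
    unfolding \<psi>_def u_tilde_def by (intro DERIV_diff DERIV_cmult D sm U)
  have \<zeta>: "((\<lambda>y. \<zeta> y t) has_real_derivative
      dx T x t - (dx (T_bar \<Theta>) x t - \<epsilon>\<^sup>2 * u_bar \<kappa> \<Theta> x t * dx (u_bar \<kappa> \<Theta>) x t)) (at x)" for x
  proof -
    \<comment> \<open>The derivative is stated in the shape produced by \<open>DERIV_power\<close>,
      with exponent \<open>2 - Suc 0\<close>, and simplified afterwards.\<close>
    have "((\<lambda>y. T y t - (T_bar \<Theta> y t - 1/2 * (\<epsilon> * u_bar \<kappa> \<Theta> y t) ^ 2)) has_real_derivative
      dx T x t - (dx (T_bar \<Theta>) x t - 1/2 * (of_nat 2 * (\<epsilon> * dx (u_bar \<kappa> \<Theta>) x t * (\<epsilon> * u_bar \<kappa> \<Theta> x t) ^ (2 - Suc 0))))) (at x)"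
      by (intro DERIV_diff DERIV_cmult DERIV_power D sm smT U)
    thus ?thesis
      by (simp add: \<zeta>_def T_tilde_def power2_eq_square mult.assoc mult.left_commute mult.commute)
  qed
  \<comment> \<open>Explicit formulas let the derivative estimate match the derivatives used in the
    interpolation, and their continuity can be read off termwise.\<close>
  have dx_eq: "(\<lambda>x. dx \<phi> x t) = (\<lambda>x. dx v x t - dx (T_bar \<Theta>) x t)"
    "(\<lambda>x. dx \<psi> x t) = (\<lambda>x. \<epsilon> * dx u x t - \<epsilon> * dx (u_bar \<kappa> \<Theta>) x t)"
    "(\<lambda>x. dx \<zeta> x t) = (\<lambda>x. dx T x t - (dx (T_bar \<Theta>) x t - \<epsilon>\<^sup>2 * u_bar \<kappa> \<Theta> x t * dx (u_bar \<kappa> \<Theta>) x t))"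
    by (simp_all add: dx_def[of \<phi>] dx_def[of \<psi>] dx_def[of \<zeta>] DERIV_imp_deriv[OF \<phi>]
        DERIV_imp_deriv[OF \<psi>] DERIV_imp_deriv[OF \<zeta>])
  note L2 = L2_norm_sq_component
  have "\<bar>\<phi> x t\<bar> \<le> sqrt (2 * C) * rate \<delta> \<epsilon> t"
    using order_trans[OF L2(1) est2] unfolding dx_eq
    by (intro stability_interpolation[OF \<phi> _ nonneg small order_trans[OF L2(1) est1]])
      (auto intro!: continuous_intros Dc sm smT)
  thus "\<bar>v x t - v_bar \<Theta> x t\<bar> \<le> sqrt (2 * C) * rate \<delta> \<epsilon> t"
    by (simp add: \<phi>_def v_tilde_def)
  have "\<bar>\<psi> x t\<bar> \<le> sqrt (2 * C) * rate \<delta> \<epsilon> t"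
    using order_trans[OF L2(2) est2] unfolding dx_eq
    by (intro stability_interpolation[OF \<psi> _ nonneg small order_trans[OF L2(2) est1]])
      (auto intro!: continuous_intros Dc sm Uc)
  moreover have "\<psi> x t = \<epsilon> * (u x t - u_bar \<kappa> \<Theta> x t)"
    by (simp add: \<psi>_def u_tilde_def right_diff_distrib)
  ultimately show "\<epsilon> * \<bar>u x t - u_bar \<kappa> \<Theta> x t\<bar> \<le> sqrt (2 * C) * rate \<delta> \<epsilon> t"
    using \<open>\<epsilon> > 0\<close> by (simp add: abs_mult)
  have "\<bar>\<zeta> x t\<bar> \<le> sqrt (2 * C) * rate \<delta> \<epsilon> t"
    using order_trans[OF L2(3) est2] unfolding dx_eq
    by (intro stability_interpolation[OF \<zeta> _ nonneg small order_trans[OF L2(3) est1]])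
      (auto intro!: continuous_intros Dc sm smT Uc c)
  thus "\<bar>T x t - T_tilde \<kappa> \<epsilon> \<Theta> x t\<bar> \<le> sqrt (2 * C) * rate \<delta> \<epsilon> t"
    by (simp add: \<zeta>_def)
qed

text \<open>Lowering an exponent enlarges a power of a base in \<open>[0, 1]\<close>, and raising it
  enlarges a power of \<open>1 + t \<ge> 1\<close>. This absorbs the discrepancy between
  \<open>T_tilde\<close> and \<open>T_bar\<close> into the rate.\<close>

lemma square_le_rate:
  assumes "0 \<le> \<delta>" "\<delta> \<le> 1" "0 < \<epsilon>" "\<epsilon> \<le> 1" "t \<ge> 0"
  shows "\<epsilon>\<^sup>2 * (\<delta>\<^sup>2 / (1 + t)) \<le> rate \<delta> \<epsilon> t"
proof -
  have small: "x\<^sup>2 \<le> x powr p" if "0 \<le> x" "x \<le> 1" "p \<le> 2" for x p :: real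
  \<comment> \<open>The case \<open>x = 0\<close> covers \<open>\<delta> = 0\<close>, where both
    sides vanish.\<close>
  proof (cases "x = 0")
    case False
    hence "x\<^sup>2 = x powr 2" using that by (simp add: powr_numeral)
    also have "\<dots> \<le> x powr p" using that by (intro powr_mono') auto
    finally show ?thesis .
  qed simp
  have "1 / (1 + t) = (1 + t) powr - 1"
    using assms by (simp add: powr_minus_divide)
  also have "\<dots> \<le> (1 + t) powr (- 1/2)"
    using assms by (intro powr_mono) auto
  finally have r: "1 / (1 + t) \<le> (1 + t) powr (- 1/2)" .
  have "\<epsilon>\<^sup>2 * (\<delta>\<^sup>2 / (1 + t)) = \<delta>\<^sup>2 * \<epsilon>\<^sup>2 * (1 / (1 + t))" by simp
  also have "\<dots> \<le> rate \<delta> \<epsilon> t"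
    unfolding rate_def using assms by (intro mult_mono r small) auto
  finally show ?thesis .
qed

text \<open>A squeeze: for \<open>p > 0\<close> the power of \<open>\<epsilon>\<close> tends to
  \<open>0\<close>, and the other two factors do not depend on \<open>\<epsilon>\<close>.\<close>

lemma tendsto_ennreal_powr_bound:
  fixes f :: "real \<Rightarrow> ennreal"
  assumes "\<epsilon>\<^sub>0 > 0" "p > 0" "\<And>\<epsilon>. 0 < \<epsilon> \<Longrightarrow> \<epsilon> \<le> \<epsilon>\<^sub>0 \<Longrightarrow> f \<epsilon> \<le> ennreal (a * \<epsilon> powr p * b)"
  shows "(f \<longlongrightarrow> 0) (at_right 0)"
proof (rule tendsto_sandwich[where f = "\<lambda>_. 0"])
  show "\<forall>\<^sub>F \<epsilon> in at_right 0. f \<epsilon> \<le> ennreal (a * \<epsilon> powr p * b)"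
    using eventually_at_right_real[OF assms(1)] by eventually_elim (use assms(3) in auto)
  have "((\<lambda>\<epsilon>. \<epsilon> powr p) \<longlongrightarrow> 0 powr p) (at_right 0)"
    using assms(2)
    by (intro tendsto_powr') (auto simp: eventually_at_filter intro!: tendsto_eq_intros)
  hence "((\<lambda>\<epsilon>. a * \<epsilon> powr p * b) \<longlongrightarrow> a * 0 * b) (at_right 0)"
    by (intro tendsto_intros) simp
  thus "((\<lambda>\<epsilon>. ennreal (a * \<epsilon> powr p * b)) \<longlongrightarrow> 0) (at_right 0)"
    using tendsto_ennrealI by fastforce
qed auto

section \<open>Convergence to the diffusive wave\<close>

text \<open>\<open>global_existence\<close> and \<open>stability\<close> carry the well-posedness
  and the energy estimates that come with the given constants. These are fixed before
  \<open>T\<^sub>p\<close>, \<open>\<Theta>\<close> and \<open>\<epsilon>\<close>, so the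
  \<open>C\<close> built from them is uniform in all three.\<close>

theorem corollary1p2:
  fixes \<mu> \<kappa> T\<^sub>m \<delta>\<^sub>1 \<epsilon>\<^sub>1 C\<^sub>1 C\<^sub>0 :: real
  assumes "\<mu> > 0" and "\<kappa> > 0" and "T\<^sub>m > 0"
    and "\<delta>\<^sub>1 > 0" and "\<epsilon>\<^sub>1 > 0" and "C\<^sub>1 > 0" and "C\<^sub>0 > 0"
    and global_existence:
      "\<And>T\<^sub>p \<Theta> \<epsilon>. T\<^sub>p > 0 \<Longrightarrow> \<bar>T\<^sub>p - T\<^sub>m\<bar> \<le> \<delta>\<^sub>1 \<Longrightarrow> self_similar_profile \<kappa> T\<^sub>m T\<^sub>p \<Theta> \<Longrightarrow>
         0 < \<epsilon> \<Longrightarrow> \<epsilon> \<le> \<epsilon>\<^sub>1 \<Longrightarrow> uniquely_solvable \<mu> \<kappa> \<epsilon> \<Theta>"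
    and stability:
      "\<And>T\<^sub>p \<Theta> \<epsilon> v u T. T\<^sub>p > 0 \<Longrightarrow> \<bar>T\<^sub>p - T\<^sub>m\<bar> \<le> \<delta>\<^sub>1 \<Longrightarrow> self_similar_profile \<kappa> T\<^sub>m T\<^sub>p \<Theta> \<Longrightarrow>
         0 < \<epsilon> \<Longrightarrow> \<epsilon> \<le> \<epsilon>\<^sub>1 \<Longrightarrow> global_smooth_solution \<mu> \<kappa> \<epsilon> \<Theta> v u T \<Longrightarrow>
         stability_estimates C\<^sub>1 C\<^sub>0 \<bar>T\<^sub>p - T\<^sub>m\<bar> \<kappa> \<epsilon> \<Theta> v u T"
  shows
    "\<exists>\<delta>\<^sub>0>0. \<exists>\<epsilon>\<^sub>0>0. \<exists>C>0. \<forall>T\<^sub>p>0. \<forall>\<delta> \<Theta>.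
       \<delta> = \<bar>T\<^sub>p - T\<^sub>m\<bar> \<and> \<delta> \<le> \<delta>\<^sub>0 \<and> self_similar_profile \<kappa> T\<^sub>m T\<^sub>p \<Theta> \<longrightarrow>
       (\<forall>\<epsilon>. 0 < \<epsilon> \<and> \<epsilon> \<le> \<epsilon>\<^sub>0 \<longrightarrow>
          uniquely_solvable \<mu> \<kappa> \<epsilon> \<Theta> \<and>
          (\<forall>v u T. global_smooth_solution \<mu> \<kappa> \<epsilon> \<Theta> v u T \<longrightarrow>
             (\<forall>t\<ge>0.
                Linf_norm (\<lambda>x. (v x t - v_bar \<Theta> x t, T x t - T_bar \<Theta> x t))
                  \<le> ennreal (C * \<delta> powr (1/4) * \<epsilon> powr (5/4) * (1 + t) powr (- 1/2)) \<and>
                Linf_norm (\<lambda>x. u x t - u_bar \<kappa> \<Theta> x t)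
                  \<le> ennreal (C * \<delta> powr (1/4) * \<epsilon> powr (1/4) * (1 + t) powr (- 1/2))))) \<and>
       (\<forall>v u T. (\<forall>\<epsilon>. 0 < \<epsilon> \<and> \<epsilon> \<le> \<epsilon>\<^sub>0 \<longrightarrow> global_smooth_solution \<mu> \<kappa> \<epsilon> \<Theta> (v \<epsilon>) (u \<epsilon>) (T \<epsilon>)) \<longrightarrow>
          (\<forall>t\<ge>0.
             ((\<lambda>\<epsilon>. Linf_norm (\<lambda>x. (v \<epsilon> x t - v_bar \<Theta> x t, T \<epsilon> x t - T_bar \<Theta> x t)))
                \<longlongrightarrow> 0) (at_right 0) \<and>
             ((\<lambda>\<epsilon>. Linf_norm (\<lambda>x. u \<epsilon> x t - u_bar \<kappa> \<Theta> x t)) \<longlongrightarrow> 0) (at_right 0)))"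
proof -
  \<comment> \<open>The constant of \<open>u_bar_bound\<close> for \<open>m = T\<^sub>m / 2\<close>
    and \<open>M = 3 * T\<^sub>m / 2\<close>; the condition
    \<open>\<delta> \<le> T\<^sub>m / 2\<close> places \<open>T\<^sub>p\<close> between these
    values.\<close>
  define K where "K = \<kappa> / (2 * (T\<^sub>m / 2)) * exp (3 * T\<^sub>m / 2 / \<kappa>)"
  \<comment> \<open>One \<open>sqrt (2 * C\<^sub>1)\<close> each for \<open>v\<close> and
    \<open>T\<close>, and \<open>K\<^sup>2\<close> for passing from \<open>T_tilde\<close> to
    \<open>T_bar\<close>.\<close>
  define C where "C = 2 * sqrt (2 * C\<^sub>1) + K\<^sup>2"
  \<comment> \<open>In order: the range of the hypotheses, \<open>square_le_rate\<close>, the lower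
    bound on \<open>T\<^sub>p\<close>, and
    \<open>C\<^sub>0 * sqrt \<delta> \<le> 1/4\<close>.\<close>
  define \<delta>\<^sub>0 where "\<delta>\<^sub>0 = Min {\<delta>\<^sub>1, 1, T\<^sub>m / 2, (1 / (4 * C\<^sub>0))\<^sup>2}"
  define \<epsilon>\<^sub>0 where "\<epsilon>\<^sub>0 = min \<epsilon>\<^sub>1 1"
  have pos: "\<delta>\<^sub>0 > 0" "\<epsilon>\<^sub>0 > 0" "C > 0"
    using assms(1-7) by (auto simp: \<delta>\<^sub>0_def \<epsilon>\<^sub>0_def C_def intro!: add_pos_nonneg)
  have estimate: "Linf_norm (\<lambda>x. (v x t - v_bar \<Theta> x t, T x t - T_bar \<Theta> x t))
        \<le> ennreal (C * \<bar>T\<^sub>p - T\<^sub>m\<bar> powr (1/4) * \<epsilon> powr (5/4) * (1 + t) powr (- 1/2)) \<and>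
      Linf_norm (\<lambda>x. u x t - u_bar \<kappa> \<Theta> x t)
        \<le> ennreal (C * \<bar>T\<^sub>p - T\<^sub>m\<bar> powr (1/4) * \<epsilon> powr (1/4) * (1 + t) powr (- 1/2))"
    if "T\<^sub>p > 0" and \<delta>\<^sub>0: "\<bar>T\<^sub>p - T\<^sub>m\<bar> \<le> \<delta>\<^sub>0" and prof: "self_similar_profile \<kappa> T\<^sub>m T\<^sub>p \<Theta>"
      and \<epsilon>: "0 < \<epsilon>" "\<epsilon> \<le> \<epsilon>\<^sub>0" and sol: "global_smooth_solution \<mu> \<kappa> \<epsilon> \<Theta> v u T" and "t \<ge> 0"
    for T\<^sub>p \<Theta> \<epsilon> v u T t
  proof -
    define \<delta> where "\<delta> = \<bar>T\<^sub>p - T\<^sub>m\<bar>"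
    define X where "X = rate \<delta> \<epsilon> t"
    have \<delta>: "0 \<le> \<delta>" "\<delta> \<le> \<delta>\<^sub>1" "\<delta> \<le> 1" "\<delta> \<le> T\<^sub>m / 2" "\<delta> \<le> (1 / (4 * C\<^sub>0))\<^sup>2"
      using \<delta>\<^sub>0 by (auto simp: \<delta>_def \<delta>\<^sub>0_def)
    have \<epsilon>': "\<epsilon> \<le> \<epsilon>\<^sub>1" "\<epsilon> \<le> 1" using \<epsilon> by (auto simp: \<epsilon>\<^sub>0_def)
    have "sqrt \<delta> \<le> 1 / (4 * C\<^sub>0)"
      using real_sqrt_le_mono[OF \<delta>(5)] \<open>C\<^sub>0 > 0\<close> by simp
    hence small: "C\<^sub>0 * sqrt \<delta> \<le> 1/4"
      using \<open>C\<^sub>0 > 0\<close> by (simp add: field_simps)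
    have "stability_estimates C\<^sub>1 C\<^sub>0 \<delta> \<kappa> \<epsilon> \<Theta> v u T"
      unfolding \<delta>_def using \<delta>(2) \<epsilon>' \<epsilon>(1) by (intro stability[OF \<open>T\<^sub>p > 0\<close> _ prof _ _ sol]) (auto simp: \<delta>_def)
    note est = stability_pointwise[OF this prof sol less_imp_le[OF \<open>C\<^sub>1 > 0\<close>] \<delta>(1) \<epsilon>(1) \<open>t \<ge> 0\<close> small, folded X_def]
    have X_nonneg: "X \<ge> 0" by (simp add: X_def rate_nonneg)
    have T: "\<bar>T x t - T_bar \<Theta> x t\<bar> \<le> (sqrt (2 * C\<^sub>1) + K\<^sup>2) * X" for x
    proof -
      have "\<bar>u_bar \<kappa> \<Theta> x t\<bar> \<le> K * \<delta> / sqrt (1 + t)"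
        unfolding K_def \<delta>_def using \<delta>(4)[unfolded \<delta>_def] \<open>T\<^sub>m > 0\<close>
        by (intro u_bar_bound[OF prof \<open>\<kappa> > 0\<close> \<open>t \<ge> 0\<close>]) linarith+
      hence "\<bar>u_bar \<kappa> \<Theta> x t\<bar>\<^sup>2 \<le> (K * \<delta> / sqrt (1 + t))\<^sup>2"
        by (intro power_mono) auto
      also have "\<dots> = K\<^sup>2 * (\<delta>\<^sup>2 / (1 + t))"
        using \<open>t \<ge> 0\<close> by (simp add: power_mult_distrib power_divide)
      finally have "\<epsilon>\<^sup>2 * \<bar>u_bar \<kappa> \<Theta> x t\<bar>\<^sup>2 \<le> \<epsilon>\<^sup>2 * (K\<^sup>2 * (\<delta>\<^sup>2 / (1 + t)))"
        by (intro mult_left_mono) auto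
      also have "\<dots> = K\<^sup>2 * (\<epsilon>\<^sup>2 * (\<delta>\<^sup>2 / (1 + t)))" by simp
      also have "\<dots> \<le> K\<^sup>2 * X"
        unfolding X_def using \<delta> \<epsilon>(1) \<epsilon>' \<open>t \<ge> 0\<close> by (intro mult_left_mono square_le_rate) auto
      finally have "\<bar>\<epsilon> * u_bar \<kappa> \<Theta> x t\<bar>\<^sup>2 \<le> K\<^sup>2 * X"
        by (simp add: power_mult_distrib)
      moreover have "T x t - T_bar \<Theta> x t = (T x t - T_tilde \<kappa> \<epsilon> \<Theta> x t) - 1/2 * \<bar>\<epsilon> * u_bar \<kappa> \<Theta> x t\<bar>\<^sup>2"
        by (simp add: T_tilde_def)
      moreover have "\<bar>\<epsilon> * u_bar \<kappa> \<Theta> x t\<bar>\<^sup>2 \<ge> 0" by simp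
      ultimately have "\<bar>T x t - T_bar \<Theta> x t\<bar> \<le> sqrt (2 * C\<^sub>1) * X + K\<^sup>2 * X"
        using est(3)[of x] by linarith
      thus ?thesis by (simp add: distrib_right)
    qed
    have "Linf_norm (\<lambda>x. (v x t - v_bar \<Theta> x t, T x t - T_bar \<Theta> x t)) \<le> ennreal (C * X)"
    proof (rule Linf_norm_le)
      show "continuous_on UNIV (\<lambda>x. (v x t - v_bar \<Theta> x t, T x t - T_bar \<Theta> x t))"
        by (intro continuous_on_Pair est)
      fix x
      have "norm (v x t - v_bar \<Theta> x t, T x t - T_bar \<Theta> x t)
          \<le> \<bar>v x t - v_bar \<Theta> x t\<bar> + \<bar>T x t - T_bar \<Theta> x t\<bar>"
        using norm_Pair_le[of "v x t - v_bar \<Theta> x t" "T x t - T_bar \<Theta> x t"] by simp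
      also have "\<dots> \<le> sqrt (2 * C\<^sub>1) * X + (sqrt (2 * C\<^sub>1) + K\<^sup>2) * X"
        by (intro add_mono est T)
      also have "\<dots> = C * X" by (simp add: C_def algebra_simps)
      finally show "norm (v x t - v_bar \<Theta> x t, T x t - T_bar \<Theta> x t) \<le> C * X" .
    qed
    moreover have "Linf_norm (\<lambda>x. u x t - u_bar \<kappa> \<Theta> x t) \<le> ennreal (C * X / \<epsilon>)"
    proof (rule Linf_norm_le[OF est(5)])
      fix x
      have "\<epsilon> * \<bar>u x t - u_bar \<kappa> \<Theta> x t\<bar> \<le> sqrt (2 * C\<^sub>1) * X" by (rule est)
      also have "\<dots> \<le> C * X"
        using \<open>C\<^sub>1 > 0\<close> X_nonneg by (intro mult_right_mono) (auto simp: C_def)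
      finally show "norm (u x t - u_bar \<kappa> \<Theta> x t) \<le> C * X / \<epsilon>"
        using \<epsilon>(1) by (simp add: field_simps)
    qed
    \<comment> \<open>Dividing by the weight \<open>\<epsilon>\<close> of the velocity costs one
      power, which turns \<open>5/4\<close> into \<open>1/4\<close>.\<close>
    moreover have "\<epsilon> powr (5/4) = \<epsilon> * \<epsilon> powr (1/4)"
      using \<epsilon>(1) powr_add[of \<epsilon> 1 "1/4"] by simp
    ultimately show ?thesis
      using \<epsilon>(1) by (simp add: X_def rate_def mult.assoc flip: \<delta>_def)
  qed
  have limits: "((\<lambda>\<epsilon>. Linf_norm (\<lambda>x. (v \<epsilon> x t - v_bar \<Theta> x t, T \<epsilon> x t - T_bar \<Theta> x t))) \<longlongrightarrow> 0) (at_right 0)"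
      "((\<lambda>\<epsilon>. Linf_norm (\<lambda>x. u \<epsilon> x t - u_bar \<kappa> \<Theta> x t)) \<longlongrightarrow> 0) (at_right 0)"
    if "T\<^sub>p > 0" "\<bar>T\<^sub>p - T\<^sub>m\<bar> \<le> \<delta>\<^sub>0" "self_similar_profile \<kappa> T\<^sub>m T\<^sub>p \<Theta>" "t \<ge> 0"
      and sol: "\<forall>\<epsilon>. 0 < \<epsilon> \<and> \<epsilon> \<le> \<epsilon>\<^sub>0 \<longrightarrow> global_smooth_solution \<mu> \<kappa> \<epsilon> \<Theta> (v \<epsilon>) (u \<epsilon>) (T \<epsilon>)"
    for T\<^sub>p \<Theta> t v u T
  proof -
    have bounds: "Linf_norm (\<lambda>x. (v \<epsilon> x t - v_bar \<Theta> x t, T \<epsilon> x t - T_bar \<Theta> x t))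
        \<le> ennreal (C * \<bar>T\<^sub>p - T\<^sub>m\<bar> powr (1/4) * \<epsilon> powr (5/4) * (1 + t) powr (- 1/2))"
      "Linf_norm (\<lambda>x. u \<epsilon> x t - u_bar \<kappa> \<Theta> x t)
        \<le> ennreal (C * \<bar>T\<^sub>p - T\<^sub>m\<bar> powr (1/4) * \<epsilon> powr (1/4) * (1 + t) powr (- 1/2))"
      if "0 < \<epsilon>" "\<epsilon> \<le> \<epsilon>\<^sub>0" for \<epsilon>
      using estimate[OF \<open>T\<^sub>p > 0\<close> \<open>\<bar>T\<^sub>p - T\<^sub>m\<bar> \<le> \<delta>\<^sub>0\<close> \<open>self_similar_profile \<kappa> T\<^sub>m T\<^sub>p \<Theta>\<close> that _ \<open>t \<ge> 0\<close>]
        sol that by blast+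
    show "((\<lambda>\<epsilon>. Linf_norm (\<lambda>x. (v \<epsilon> x t - v_bar \<Theta> x t, T \<epsilon> x t - T_bar \<Theta> x t))) \<longlongrightarrow> 0) (at_right 0)"
      by (rule tendsto_ennreal_powr_bound[OF pos(2) _ bounds(1)]) auto
    show "((\<lambda>\<epsilon>. Linf_norm (\<lambda>x. u \<epsilon> x t - u_bar \<kappa> \<Theta> x t)) \<longlongrightarrow> 0) (at_right 0)"
      by (rule tendsto_ennreal_powr_bound[OF pos(2) _ bounds(2)]) auto
  qed
  have solvable: "uniquely_solvable \<mu> \<kappa> \<epsilon> \<Theta>"
    if "T\<^sub>p > 0" "\<bar>T\<^sub>p - T\<^sub>m\<bar> \<le> \<delta>\<^sub>0" "self_similar_profile \<kappa> T\<^sub>m T\<^sub>p \<Theta>" "0 < \<epsilon>" "\<epsilon> \<le> \<epsilon>\<^sub>0" for T\<^sub>p \<Theta> \<epsilon>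
    using that by (intro global_existence) (auto simp: \<delta>\<^sub>0_def \<epsilon>\<^sub>0_def)
  show ?thesis
  proof (rule exI[of _ \<delta>\<^sub>0], intro conjI pos, rule exI[of _ \<epsilon>\<^sub>0], intro conjI pos,
      rule exI[of _ C], intro conjI pos allI impI)
    fix T\<^sub>p \<delta> \<Theta>
    assume "T\<^sub>p > 0" and "\<delta> = \<bar>T\<^sub>p - T\<^sub>m\<bar> \<and> \<delta> \<le> \<delta>\<^sub>0 \<and> self_similar_profile \<kappa> T\<^sub>m T\<^sub>p \<Theta>"
    hence \<delta>: "\<delta> = \<bar>T\<^sub>p - T\<^sub>m\<bar>"
      and hyps: "T\<^sub>p > 0" "\<bar>T\<^sub>p - T\<^sub>m\<bar> \<le> \<delta>\<^sub>0" "self_similar_profile \<kappa> T\<^sub>m T\<^sub>p \<Theta>"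
      by auto
    {
      fix \<epsilon> assume "0 < \<epsilon> \<and> \<epsilon> \<le> \<epsilon>\<^sub>0"
      hence \<epsilon>: "0 < \<epsilon>" "\<epsilon> \<le> \<epsilon>\<^sub>0" by auto
      show "uniquely_solvable \<mu> \<kappa> \<epsilon> \<Theta>" by (rule solvable[OF hyps \<epsilon>])
      fix v u T and t :: real
      assume sol: "global_smooth_solution \<mu> \<kappa> \<epsilon> \<Theta> v u T" "0 \<le> t"
      show "Linf_norm (\<lambda>x. (v x t - v_bar \<Theta> x t, T x t - T_bar \<Theta> x t))
          \<le> ennreal (C * \<delta> powr (1/4) * \<epsilon> powr (5/4) * (1 + t) powr (- 1/2))"
        unfolding \<delta> by (rule estimate[OF hyps \<epsilon> sol, THEN conjunct1])
      show "Linf_norm (\<lambda>x. u x t - u_bar \<kappa> \<Theta> x t)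
          \<le> ennreal (C * \<delta> powr (1/4) * \<epsilon> powr (1/4) * (1 + t) powr (- 1/2))"
        unfolding \<delta> by (rule estimate[OF hyps \<epsilon> sol, THEN conjunct2])
    }
    fix v u T and t :: real
    assume sol: "\<forall>\<epsilon>. 0 < \<epsilon> \<and> \<epsilon> \<le> \<epsilon>\<^sub>0 \<longrightarrow> global_smooth_solution \<mu> \<kappa> \<epsilon> \<Theta> (v \<epsilon>) (u \<epsilon>) (T \<epsilon>)"
      and "0 \<le> t"
    show "((\<lambda>\<epsilon>. Linf_norm (\<lambda>x. (v \<epsilon> x t - v_bar \<Theta> x t, T \<epsilon> x t - T_bar \<Theta> x t))) \<longlongrightarrow> 0) (at_right 0)"
      by (rule limits(1)[OF hyps \<open>0 \<le> t\<close> sol])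
    show "((\<lambda>\<epsilon>. Linf_norm (\<lambda>x. u \<epsilon> x t - u_bar \<kappa> \<Theta> x t)) \<longlongrightarrow> 0) (at_right 0)"
      by (rule limits(2)[OF hyps \<open>0 \<le> t\<close> sol])
  qed
qed

end
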